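(* Let $d\geqslant1$ and $0<\alpha<2$. If $u:\mathbb{Z}^d\to\mathbb{C}$ satisfies $$\sum_{y\neq x}\frac{|u(x)-u(y)|}{d(x,y)^{d+\alpha}}<+\infty\quad\text{for every }x\in\mathbb{Z}^d,$$ then the fractional Laplacian $(-\Delta)^{\frac{\alpha}{2}}u$ is well-defined. That is, for every $x\in\mathbb{Z}^d$: the series $e^{t\Delta}u(x)=\sum_{y}p(t,x,y)u(y)$ converges absolutely for every $t>0$, the integral $$(-\Delta)^{\frac{\alpha}{2}}u(x)=\frac{1}{|\Gamma(-\frac{\alpha}{2})|}\int_0^\infty(u(x)-e^{t\Delta}u(x))t^{-1-\frac{\alpha}{2}}dt$$ converges absolutely, and $$(-\Delta)^{\frac{\alpha}{2}}u(x)=\sum_{y\neq x}Q_\alpha(x,y)(u(x)-u(y)).$$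
   Context: $\mathbb{Z}^d$ is the integer lattice regarded as a graph, with $x\sim y$ iff $x-y\in\{\pm e_1,\dots,\pm e_d\}$, where $e_i$ are the standard unit vectors; $d(x,y)$ denotes the graph distance. The graph Laplacian is $\Delta f(x)=\sum_{y\sim x}(f(y)-f(x))$. The heat kernel $p(t,x,y)$ on $\mathbb{Z}^d$ is the kernel of the heat semigroup $e^{t\Delta}$: for each $y$, $(t,x)\mapsto p(t,x,y)$ is the bounded solution of $\partial_t v=\Delta v$ with initial value $1_{\{x=y\}}$; it satisfies $\sum_y p(t,x,y)=1$. For $x\neq y$, $$Q_\alpha(x,y)=\frac{1}{|\Gamma(-\frac{\alpha}{2})|}\int_0^\infty t^{-1-\frac{\alpha}{2}}p(t,x,y)\,dt.$$ *)

theory Defs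
  imports "HOL-Analysis.Analysis"
begin

text \<open>
  The lattice of dimension \<open>d \<ge> 1\<close> is \<^typ>\<open>int ^ 'd\<close> with \<open>d = CARD('d)\<close>.
\<close>

definition lattice_adj :: "int ^ 'd \<Rightarrow> int ^ 'd \<Rightarrow> bool" where
  "lattice_adj x y \<longleftrightarrow> (\<exists>i. x - y = axis i 1 \<or> x - y = - axis i 1)"

text \<open>The graph distance is the least number of edges of a walk from \<open>x\<close> to \<open>y\<close>.\<close>

definition lattice_dist :: "int ^ 'd \<Rightarrow> int ^ 'd \<Rightarrow> nat" where
  "lattice_dist x y = (LEAST n. (lattice_adj ^^ n) x y)"

definition lattice_laplacian :: "(int ^ 'd \<Rightarrow> real) \<Rightarrow> int ^ 'd \<Rightarrow> real" where
  "lattice_laplacian f x = (\<Sum>y | lattice_adj x y. f y - f x)"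

text \<open>
  \<open>v\<close> is a bounded solution on \<open>[0, \<infinity>)\<close> of the heat equation whose initial value is the
  indicator of \<open>{y}\<close>; at \<open>t = 0\<close> the time derivative is one-sided. Values at \<open>t < 0\<close> are
  unconstrained.
\<close>

definition bounded_heat_solution :: "int ^ 'd \<Rightarrow> (real \<Rightarrow> int ^ 'd \<Rightarrow> real) \<Rightarrow> bool" where
  "bounded_heat_solution y v \<longleftrightarrow>
     (\<exists>C. \<forall>t\<ge>0. \<forall>x. \<bar>v t x\<bar> \<le> C) \<and>
     (\<forall>x. v 0 x = (if x = y then 1 else 0)) \<and>
     (\<forall>t\<ge>0. \<forall>x. ((\<lambda>s. v s x) has_real_derivative lattice_laplacian (v t) x) (at t within {0..}))"

text \<open>
  A bounded solution exists and is unique for \<open>t \<ge> 0\<close>, so the description below is proper there;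
  \<open>heat_kernel t\<close> is only meaningful for such \<open>t\<close>.
\<close>

definition heat_kernel :: "real \<Rightarrow> int ^ 'd \<Rightarrow> int ^ 'd \<Rightarrow> real" where
  "heat_kernel t x y = (THE p. \<exists>v. bounded_heat_solution y v \<and> p = v t x)"

definition heat_semigroup :: "real \<Rightarrow> (int ^ 'd \<Rightarrow> complex) \<Rightarrow> int ^ 'd \<Rightarrow> complex" where
  "heat_semigroup t u x = (\<Sum>\<^sub>\<infinity>y. of_real (heat_kernel t x y) * u y)"

definition Q_kernel :: "real \<Rightarrow> int ^ 'd \<Rightarrow> int ^ 'd \<Rightarrow> real" where
  "Q_kernel \<alpha> x y =
     1 / \<bar>Gamma (- (\<alpha> / 2))\<bar> * (LBINT t:{0<..}. t powr (- 1 - \<alpha> / 2) * heat_kernel t x y)"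

definition frac_laplacian_integrand ::
    "real \<Rightarrow> (int ^ 'd \<Rightarrow> complex) \<Rightarrow> int ^ 'd \<Rightarrow> real \<Rightarrow> complex" where
  "frac_laplacian_integrand \<alpha> u x t =
     (u x - heat_semigroup t u x) * of_real (t powr (- 1 - \<alpha> / 2))"

definition frac_laplacian :: "real \<Rightarrow> (int ^ 'd \<Rightarrow> complex) \<Rightarrow> int ^ 'd \<Rightarrow> complex" where
  "frac_laplacian \<alpha> u x =
     of_real (1 / \<bar>Gamma (- (\<alpha> / 2))\<bar>) * (LBINT t:{0<..}. frac_laplacian_integrand \<alpha> u x t)"

end

theory Submission
  imports Defs
begin

text \<open>
  The heat kernel of the lattice is the product of one-dimensional kernels \<open>q\<close>, by uniqueness of
  bounded solutions. The recurrence \<open>k q(t,k) = t (q(t,k - 1) - q(t,k + 1))\<close>, telescoped along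
  \<open>j, j + 2, \<dots>, j + 2 l\<close>, gives \<open>l\<^sup>2 q(t,j + 2 l) \<le> t q(t,j)\<close> since \<open>q(t,\<cdot>)\<close> decreases on
  \<open>k \<ge> 0\<close>. Iterating \<open>m\<close> times and using \<open>q(t,0) \<le> t powr (-1/2)\<close> bounds the heat kernel by multiples of
  \<open>t / |z|^(2m)\<close> for \<open>t \<le> 1\<close>, and of \<open>t powr (-d/2) * min(1, (t / |z|^2)^m)\<close> for \<open>t \<ge> 1\<close>. With \<open>m = d + 1\<close>
  the time integral defining \<open>Q\<^sub>\<alpha>\<close> is therefore \<open>O(|z| powr (-d - \<alpha>))\<close>, and the hypothesis on \<open>u\<close> is exactly
  what Tonelli and Fubini need to integrate \<open>u(x) - (exp (t\<Delta>) u)(x) = \<Sum>\<^sub>y p(t,x,y) (u(x) - u(y))\<close> termwise.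
\<close>

section \<open>The one-dimensional heat kernel\<close>

text \<open>
  \<open>lazy_walks n k\<close> is the coefficient of \<open>z^k\<close> in \<open>(z + 2 + 1/z)^n\<close>, i.e. \<open>2n choose (n + k)\<close>. The middle
  weight makes it monotone in \<open>|k|\<close>; walks without holding would be sensitive to parity.
\<close>

fun lazy_walks :: "nat \<Rightarrow> int \<Rightarrow> real" where
  "lazy_walks 0 k = (if k = 0 then 1 else 0)"
| "lazy_walks (Suc n) k = lazy_walks n (k - 1) + 2 * lazy_walks n k + lazy_walks n (k + 1)"

section \<open>Walk counts: symmetry, total mass, monotonicity and size at the origin\<close>

lemma lazy_walks_nonneg: "0 \<le> lazy_walks n k"
  by (induction n arbitrary: k) auto

lemma lazy_walks_minus: "lazy_walks n (- k) = lazy_walks n k"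
proof (induction n arbitrary: k)
  case (Suc n)
  have "lazy_walks n (- k - 1) = lazy_walks n (k + 1)" "lazy_walks n (- k + 1) = lazy_walks n (k - 1)"
    using Suc[of "k + 1"] Suc[of "k - 1"] by (simp_all add: minus_diff_commute)
  then show ?case
    by (simp add: Suc)
qed auto

lemma lazy_walks_has_sum: "(lazy_walks n has_sum 4 ^ n) UNIV"
proof (induction n)
  case 0
  have "(lazy_walks 0 has_sum 1) {0}"
    by (simp add: has_sum_finite_iff)
  then have "(lazy_walks 0 has_sum 1) UNIV"
    by (subst has_sum_cong_neutral[where g = "lazy_walks 0" and T = "{0}"]) auto
  then show ?case
    by (simp only: power_0)
next
  case (Suc n)
  have 1: "((\<lambda>k. lazy_walks n (k - 1)) has_sum 4 ^ n) UNIV"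
    using Suc by (subst has_sum_reindex_bij_witness[of UNIV "\<lambda>k. k + 1" "\<lambda>k. k - 1" UNIV "lazy_walks n"]) auto
  have 2: "((\<lambda>k. lazy_walks n (k + 1)) has_sum 4 ^ n) UNIV"
    using Suc by (subst has_sum_reindex_bij_witness[of UNIV "\<lambda>k. k - 1" "\<lambda>k. k + 1" UNIV "lazy_walks n"]) auto
  have "((\<lambda>k. lazy_walks n (k - 1) + 2 * lazy_walks n k + lazy_walks n (k + 1)) has_sum
      (4 ^ n + 2 * 4 ^ n + 4 ^ n)) UNIV"
    by (intro has_sum_add has_sum_cmult_right 1 2 Suc)
  then show ?case
    by simp
qed

lemma lazy_walks_le: "lazy_walks n k \<le> 4 ^ n"
proof (induction n arbitrary: k)
  case (Suc n)
  show ?case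
    using Suc[of k] Suc[of "k - 1"] Suc[of "k + 1"] by simp
qed auto

text \<open>By the recurrence, the drop from \<open>k\<close> to \<open>k + 1\<close> at level
  \<open>Suc n\<close> is the drop at \<open>k - 1\<close>, plus twice the drop at \<open>k\<close>,
  plus the drop at \<open>k + 1\<close>, all at level \<open>n\<close>. For \<open>k = 0\<close> the
  first is negative, but by symmetry one of the two copies of the middle drop cancels it.\<close>

lemma lazy_walks_decreasing: "0 \<le> k \<Longrightarrow> lazy_walks n (k + 1) \<le> lazy_walks n k"
proof (induction n arbitrary: k)
  case (Suc n)
  have *: "lazy_walks n (k + 2) \<le> lazy_walks n (k + 1)" "lazy_walks n (k + 1) \<le> lazy_walks n k"
    using Suc.IH[of "k + 1"] Suc.IH[of k] Suc.prems by (auto simp: add.commute)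
  show ?case
  proof (cases "k = 0")
    case True
    then show ?thesis
      using * lazy_walks_minus[of n 1] by simp
  next
    case False
    then have "lazy_walks n k \<le> lazy_walks n (k - 1)"
      using Suc.IH[of "k - 1"] Suc.prems by simp
    then show ?thesis
      using * by (simp add: add.commute)
  qed
qed auto

text \<open>Compares coefficients of z^k in the identity obtained by applying z d/dz to (z + 2 +
  1/z)^(n+1), namely (n + 1) (z - 1/z) (z + 2 + 1/z)^n.\<close>

lemma lazy_walks_index_mult:
  "real_of_int k * lazy_walks (Suc n) k = real (Suc n) * (lazy_walks n (k - 1) - lazy_walks n (k + 1))"
proof (induction n arbitrary: k)
  case 0
  then show ?case
    by auto
next
  case (Suc n)
  show ?case
    using Suc[of "k - 1"] Suc[of k] Suc[of "k + 1"]
    by (simp add: algebra_simps)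
qed

text \<open>This is the quotient of the neighbouring binomials \<open>2n choose (n + k + 1)\<close>
  and \<open>2n choose (n + k)\<close>, cleared of denominators so that it holds for every integer
  \<open>k\<close>.\<close>

lemma lazy_walks_ratio:
  "(real n + 1 + of_int k) * lazy_walks n (k + 1) = (real n - of_int k) * lazy_walks n k"
proof (induction n arbitrary: k)
  case 0
  then show ?case
    by auto
next
  case (Suc n)
  show ?case
    using Suc[of "k - 1"] Suc[of k] Suc[of "k + 1"]
    by (simp add: algebra_simps)
qed

text \<open>The central binomial bound is proved in squared form, free of roots. From
  \<open>n\<close> to \<open>n + 1\<close> the left side is multiplied by (4n + 2)^2 (n + 2) / (n +
  1)^3, which is at most 16.\<close>

lemma lazy_walks_zero_le: "lazy_walks n 0 \<le> 4 ^ n / sqrt (real n + 1)"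
proof -
  have "(lazy_walks n 0)\<^sup>2 * (real n + 1) \<le> 16 ^ n"
  proof (induction n)
    case (Suc n)
    have "lazy_walks (Suc n) 0 = 2 * lazy_walks n 0 + 2 * lazy_walks n 1"
      using lazy_walks_minus[of n 1] by simp
    moreover have "(real n + 1) * lazy_walks n 1 = real n * lazy_walks n 0"
      using lazy_walks_ratio[of n 0] by simp
    ultimately have "(real n + 1) * lazy_walks (Suc n) 0 = (4 * real n + 2) * lazy_walks n 0"
      by (simp add: algebra_simps)
    then have b: "lazy_walks (Suc n) 0 = (4 * real n + 2) * lazy_walks n 0 / (real n + 1)"
      by (simp add: field_simps del: lazy_walks.simps)
    have "(lazy_walks (Suc n) 0)\<^sup>2 * (real (Suc n) + 1)
        = ((lazy_walks n 0)\<^sup>2 * (real n + 1)) * ((4 * real n + 2)\<^sup>2 * (real n + 2) / (real n + 1) ^ 3)"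
      unfolding b
      by (simp add: power_divide power_mult_distrib divide_simps power2_eq_square power3_eq_cube
          del: lazy_walks.simps)
    also have "\<dots> \<le> 16 ^ n * 16"
    proof (intro mult_mono Suc)
      show "(4 * real n + 2)\<^sup>2 * (real n + 2) / (real n + 1) ^ 3 \<le> 16"
        by (simp add: divide_simps power2_eq_square power3_eq_cube) (simp add: algebra_simps)
    qed auto
    finally show ?case
      by simp
  qed auto
  then have "(lazy_walks n 0 * sqrt (real n + 1))\<^sup>2 \<le> (4 ^ n)\<^sup>2"
    by (simp add: power_mult_distrib power_mult[symmetric] mult.commute[of n 2]) (simp add: power_mult)
  then have "lazy_walks n 0 * sqrt (real n + 1) \<le> 4 ^ n"
    by (rule power2_le_imp_le) simp
  then show ?thesis
    by (simp add: field_simps)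
qed

section \<open>The line kernel as a Poisson mixture of lazy walks\<close>

definition lazy_series :: "int \<Rightarrow> real \<Rightarrow> real" where
  "lazy_series k t = (\<Sum>n. lazy_walks n k / fact n * t ^ n)"

text \<open>The coefficient of z^k in exp(t (z - 2 + 1/z)), that is exp(-2t) I_k(2t) with the
  modified Bessel function I_k. Equivalently, the law of a lazy walk after a Poisson number of steps
  with mean 4t.\<close>

definition line_kernel :: "real \<Rightarrow> int \<Rightarrow> real" where
  "line_kernel t k = exp (- 4 * t) * lazy_series k t"

lemma summable_lazy: "summable (\<lambda>n. lazy_walks n k / fact n * t ^ n)"
proof (rule summable_comparison_test')
  show "summable (\<lambda>n. (4 * \<bar>t\<bar>) ^ n /\<^sub>R fact n)"
    by (rule summable_exp_generic)
  show "norm (lazy_walks n k / fact n * t ^ n) \<le> (4 * \<bar>t\<bar>) ^ n /\<^sub>R fact n" for n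
    using lazy_walks_le[of n k] lazy_walks_nonneg[of n k]
    by (simp add: power_mult_distrib power_abs abs_mult divide_simps mult_right_mono)
qed

text \<open>Differentiating a power series with weights 1/n! shifts the coefficients from
  \<open>n\<close> to \<open>Suc n\<close>, where the recursion of \<open>lazy_walks\<close> splits
  them into three.\<close>

lemma lazy_series_deriv:
  "(lazy_series k has_real_derivative
      lazy_series (k - 1) t + 2 * lazy_series k t + lazy_series (k + 1) t) (at t)"
proof -
  let ?c = "\<lambda>k n. lazy_walks n k / fact n"
  have "((\<lambda>t. \<Sum>n. ?c k n * t ^ n) has_real_derivative (\<Sum>n. diffs (?c k) n * t ^ n)) (at t)"
    by (rule termdiffs_strong_converges_everywhere) (rule summable_lazy)
  moreover have "diffs (?c k) n * t ^ n =
      ?c (k - 1) n * t ^ n + 2 * (?c k n * t ^ n) + ?c (k + 1) n * t ^ n" for n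
    by (simp add: diffs_def field_simps del: of_nat_Suc)
  moreover have "(\<lambda>n. ?c (k - 1) n * t ^ n + 2 * (?c k n * t ^ n) + ?c (k + 1) n * t ^ n) sums
     (lazy_series (k - 1) t + 2 * lazy_series k t + lazy_series (k + 1) t)"
    unfolding lazy_series_def by (intro sums_add sums_mult summable_sums summable_lazy)
  ultimately show ?thesis
    unfolding lazy_series_def[abs_def] by (simp add: sums_iff)
qed

lemma line_kernel_deriv:
  "((\<lambda>t. line_kernel t k) has_real_derivative
      line_kernel t (k - 1) - 2 * line_kernel t k + line_kernel t (k + 1)) (at t)"
  unfolding line_kernel_def
  by (rule derivative_eq_intros lazy_series_deriv refl)+ (simp add: algebra_simps)

lemma line_kernel_minus: "line_kernel t (- k) = line_kernel t k"
  by (simp add: line_kernel_def lazy_series_def lazy_walks_minus)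

lemma line_kernel_abs: "line_kernel t \<bar>k\<bar> = line_kernel t k"
  by (simp add: abs_if line_kernel_minus)

lemma line_kernel_0: "line_kernel 0 k = (if k = 0 then 1 else 0)"
  by (simp add: line_kernel_def lazy_series_def powser_zero flip: times_divide_eq_left)

lemma line_kernel_nonneg: "0 \<le> t \<Longrightarrow> 0 \<le> line_kernel t k"
  unfolding line_kernel_def lazy_series_def
  by (intro mult_nonneg_nonneg suminf_nonneg summable_lazy) (auto simp: lazy_walks_nonneg)

text \<open>The double series over \<open>n\<close> and \<open>k\<close> has nonnegative terms, so
  it may be summed in either order; the sum over \<open>k\<close> first leaves the exponential
  series of 4t.\<close>

lemma line_kernel_has_sum:
  assumes "0 \<le> t"
  shows "(line_kernel t has_sum 1) UNIV"
proof -
  let ?f = "\<lambda>n k. lazy_walks n k / fact n * t ^ n"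
  have row: "((\<lambda>k. ?f n k) has_sum ((4 * t) ^ n / fact n)) UNIV" for n
    using has_sum_cmult_left[OF lazy_walks_has_sum[of n], of "t ^ n / fact n"]
    by (simp add: power_mult_distrib)
  have e: "((\<lambda>n. (4 * t) ^ n / fact n) has_sum exp (4 * t)) UNIV"
    using assms exp_converges[of "4 * t"]
    by (intro norm_summable_imp_has_sum) (auto simp: divide_inverse_commute sums_iff)
  have s: "(\<lambda>(n, k). ?f n k) summable_on UNIV \<times> UNIV"
    using e row assms
    by (intro summable_on_SigmaI[where g = "\<lambda>n. (4 * t) ^ n / fact n"])
       (auto simp: lazy_walks_nonneg dest: has_sum_imp_summable)
  then have S: "((\<lambda>(n, k). ?f n k) has_sum exp (4 * t)) (UNIV \<times> UNIV)"
    using has_sum_SigmaI[OF _ e s] row by auto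
  then have "((\<lambda>(k, n). ?f n k) has_sum exp (4 * t)) (UNIV \<times> UNIV)"
    by (subst (asm) has_sum_swap) simp
  moreover have "((\<lambda>n. ?f n k) has_sum lazy_series k t) UNIV" for k
    unfolding lazy_series_def using assms summable_lazy[of k t]
    by (intro norm_summable_imp_has_sum) (auto simp: lazy_walks_nonneg abs_mult summable_sums)
  ultimately have "((\<lambda>k. lazy_series k t) has_sum exp (4 * t)) UNIV"
    by (intro has_sum_SigmaD[where f = "\<lambda>(k, n). ?f n k" and A = UNIV and B = "\<lambda>_. UNIV"]) auto
  from has_sum_cmult_right[OF this, of "exp (- 4 * t)"] show ?thesis
    by (simp add: line_kernel_def[abs_def] exp_minus)
qed

lemma line_kernel_le_1: "0 \<le> t \<Longrightarrow> line_kernel t k \<le> 1"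
  using has_sum_mono_neutral[OF has_sum_finite[of "{k}" "line_kernel t"] line_kernel_has_sum[of t]]
  by (auto simp: line_kernel_nonneg)

lemma line_kernel_decreasing:
  assumes "0 \<le> t" "0 \<le> k"
  shows "line_kernel t (k + 1) \<le> line_kernel t k"
  unfolding line_kernel_def lazy_series_def using assms
  by (intro mult_left_mono suminf_le summable_lazy mult_right_mono divide_right_mono lazy_walks_decreasing) auto

lemma line_kernel_antimono:
  assumes "0 \<le> t" "0 \<le> j" "j \<le> k"
  shows "line_kernel t k \<le> line_kernel t j"
  using \<open>j \<le> k\<close>
proof (induction k rule: int_ge_induct)
  case (step k)
  then show ?case
    using line_kernel_decreasing[of t k] assms by linarith
qed simp

text \<open>The Bessel recurrence I_(k-1) - I_(k+1) = (2k/x) I_k at x = 2t. It follows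
  coefficientwise from \<open>lazy_walks_index_mult\<close>, since (n + 1) / (n + 1)! =
  1/n!.\<close>

lemma line_kernel_index_mult:
  "of_int k * line_kernel t k = t * (line_kernel t (k - 1) - line_kernel t (k + 1))"
proof -
  let ?f = "\<lambda>n. of_int k * (lazy_walks n k / fact n * t ^ n)"
  have s: "summable ?f"
    by (intro summable_mult summable_lazy)
  have "?f (Suc n) = t * (lazy_walks n (k - 1) / fact n * t ^ n - lazy_walks n (k + 1) / fact n * t ^ n)" for n
  proof -
    have "?f (Suc n) = (of_int k * lazy_walks (Suc n) k) / fact (Suc n) * t ^ Suc n"
      by simp
    then show ?thesis
      unfolding lazy_walks_index_mult by (simp add: field_simps del: of_nat_Suc lazy_walks.simps)
  qed
  then have "(\<lambda>n. ?f (Suc n)) sums (t * (lazy_series (k - 1) t - lazy_series (k + 1) t))"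
    unfolding lazy_series_def by (simp only:) (intro sums_mult sums_diff summable_sums summable_lazy)
  \<comment> \<open>The constant term must vanish because the right side carries a factor
    \<open>t\<close>: \<open>lazy_walks 0 k\<close> is nonzero only at \<open>k = 0\<close>, where
    the factor \<open>k\<close> kills it.\<close>
  moreover have "?f 0 = 0"
    by simp
  ultimately have "of_int k * lazy_series k t = t * (lazy_series (k - 1) t - lazy_series (k + 1) t)"
    using suminf_split_head[OF s] suminf_mult[OF summable_lazy, of "of_int k" k t]
    by (simp add: sums_iff lazy_series_def)
  then have "exp (- 4 * t) * (of_int k * lazy_series k t) =
      exp (- 4 * t) * (t * (lazy_series (k - 1) t - lazy_series (k + 1) t))"
    by simp
  then show ?thesis
    by (simp add: line_kernel_def right_diff_distrib mult.left_commute)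
qed

text \<open>Averages \<open>lazy_walks_zero_le\<close> over the Poisson weights. The average of 1/(n
  + 1) is explicit because ?a n / (n + 1) is ?a (n + 1) / (4t).\<close>

lemma line_kernel_zero_le:
  assumes "0 < t"
  shows "line_kernel t 0 \<le> 1 / sqrt t"
proof -
  let ?a = "\<lambda>n. (4 * t) ^ n / fact n"
  have a: "?a sums exp (4 * t)"
    using exp_converges[of "4 * t"] by (simp add: divide_inverse_commute)
  have "(\<lambda>n. ?a (Suc n)) sums (exp (4 * t) - 1)"
    using a by (subst sums_Suc_iff) simp
  from sums_mult[OF this, of "1 / (4 * t)"]
  have a1: "(\<lambda>n. ?a n / (real n + 1)) sums ((exp (4 * t) - 1) / (4 * t))"
    using assms by (simp add: field_simps)
  let ?h = "\<lambda>n. (sqrt t * (?a n / (real n + 1)) + ?a n / sqrt t) / 2"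
  have h: "?h sums ((sqrt t * ((exp (4 * t) - 1) / (4 * t)) + exp (4 * t) / sqrt t) / 2)"
    by (intro sums_divide sums_add sums_mult a a1)
  have "lazy_series 0 t \<le> suminf ?h"
    unfolding lazy_series_def
  proof (intro suminf_le summable_lazy sums_summable[OF h])
    fix n
    define r where "r = sqrt (real n + 1)"
    define s where "s = sqrt t"
    have rs: "r > 0" "s > 0" "r * r = real n + 1"
      using assms by (auto simp: r_def s_def)
    \<comment> \<open>AM-GM trades \<open>1 / sqrt (n + 1)\<close> for \<open>1 / (n + 1)\<close>, whose exponential average is explicit.\<close>
    have "(s / (r * r) + 1 / s) / 2 - 1 / r = (s - r)\<^sup>2 / (2 * s * (r * r))"
      using rs(1,2) by (simp add: divide_simps power2_eq_square) (simp add: algebra_simps)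
    moreover have "0 \<le> (s - r)\<^sup>2 / (2 * s * (r * r))"
      using rs(1,2) by simp
    ultimately have "1 / r \<le> (s / (r * r) + 1 / s) / 2"
      by linarith
    then have "?a n * (1 / r) \<le> ?a n * ((s / (r * r) + 1 / s) / 2)"
      using assms by (intro mult_left_mono) auto
    also have "\<dots> = ?h n"
      unfolding rs(3) s_def by (simp add: algebra_simps add_divide_distrib)
    finally have "?a n * (1 / r) \<le> ?h n" .
    moreover have "lazy_walks n 0 / fact n * t ^ n \<le> ?a n * (1 / r)"
      using lazy_walks_zero_le[of n] assms
        mult_right_mono[of "lazy_walks n 0" "4 ^ n / r" "t ^ n / fact n"]
      by (simp add: r_def power_mult_distrib mult.commute)
    ultimately show "lazy_walks n 0 / fact n * t ^ n \<le> ?h n"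
      by linarith
  qed
  also have "suminf ?h = (sqrt t * ((exp (4 * t) - 1) / (4 * t)) + exp (4 * t) / sqrt t) / 2"
    using h by (simp add: sums_iff)
  \<comment> \<open>Enlarging 1/(4t) to 1/t makes both halves of the mean equal, so the final
    constant is 1.\<close>
  also have "\<dots> \<le> (sqrt t * (exp (4 * t) / t) + exp (4 * t) / sqrt t) / 2"
    using assms by (intro divide_right_mono add_right_mono mult_left_mono frac_le) auto
  also have "sqrt t * (exp (4 * t) / t) = exp (4 * t) / sqrt t"
    using assms by (simp add: field_simps)
  finally have "lazy_series 0 t \<le> exp (4 * t) / sqrt t"
    by simp
  then show ?thesis
    by (simp add: line_kernel_def exp_minus field_simps)
qed

section \<open>Spatial decay of the line kernel\<close>

lemma line_kernel_step:
  assumes "0 \<le> t" "0 \<le> j"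
  shows "line_kernel t (j + 2 * int l) * real l ^ 2 \<le> t * line_kernel t j"
proof -
  \<comment> \<open>The subtracted term makes the induction telescope and is dropped at the end. The
    square arises as the sum of the odd numbers 1, 3, ..., 2l - 1, because the recurrence at index j
    + 2l + 1 contributes a factor of at least 2l + 1.\<close>
  have "(line_kernel t (j + 2 * int l)) * real l ^ 2
      \<le> t * (line_kernel t j - line_kernel t (j + 2 * int l))"
    if "j \<ge> 0" for j
    using that
  proof (induction l)
    case (Suc l)
    let ?q = "line_kernel t"
    have "of_int (j + 2 * int l + 1) * ?q (j + 2 * int l + 1) = t * (?q (j + 2 * int l) - ?q (j + 2 * int (Suc l)))"
      using line_kernel_index_mult[of "j + 2 * int l + 1" t] by (simp add: algebra_simps)
    moreover have "(2 * real l + 1) * ?q (j + 2 * int (Suc l)) \<le> of_int (j + 2 * int l + 1) * ?q (j + 2 * int l + 1)"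
      using Suc assms by (intro mult_mono line_kernel_antimono line_kernel_nonneg) auto
    moreover have "?q (j + 2 * int (Suc l)) * real l ^ 2 \<le> ?q (j + 2 * int l) * real l ^ 2"
      using Suc assms by (intro mult_right_mono line_kernel_antimono) auto
    ultimately show ?case
      using Suc by (simp add: algebra_simps power2_eq_square)
  qed auto
  from this[OF \<open>0 \<le> j\<close>] show ?thesis
    using mult_nonneg_nonneg[OF \<open>0 \<le> t\<close> line_kernel_nonneg[OF \<open>0 \<le> t\<close>, of "j + 2 * int l"]]
    by (simp add: algebra_simps)
qed

lemma line_kernel_iterate:
  assumes "0 \<le> t"
  shows "line_kernel t (2 * int l * int m) * real l ^ (2 * m) \<le> t ^ m * line_kernel t 0"
proof (induction m)
  case (Suc m)
  have "line_kernel t (2 * int l * int (Suc m)) * real l ^ (2 * Suc m)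
      = (line_kernel t (2 * int l * int m + 2 * int l) * real l ^ 2) * real l ^ (2 * m)"
    by (simp add: algebra_simps power2_eq_square)
  also have "\<dots> \<le> t * line_kernel t (2 * int l * int m) * real l ^ (2 * m)"
    using assms by (intro mult_right_mono line_kernel_step) auto
  also have "\<dots> \<le> t * (t ^ m * line_kernel t 0)"
    using Suc assms mult_left_mono[OF Suc, of t] by (simp add: mult.assoc)
  finally show ?case
    by (simp add: mult.assoc)
qed auto

lemma line_kernel_tail:
  assumes "0 \<le> t" "0 < m" "2 * int m \<le> \<bar>k\<bar>"
  shows "line_kernel t k * \<bar>of_int k\<bar> ^ (2 * m) \<le> real (4 * m) ^ (2 * m) * t ^ m * line_kernel t 0"
proof -
  define K where "K = nat \<bar>k\<bar>"
  \<comment> \<open>The stride 2l fits \<open>m\<close> times into \<open>K\<close>, and since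
    \<open>l\<close> is at least 1 the rounding loses at most a factor 2: 2ml <= K <= 4ml. Hence the
    constant 4m.\<close>
  define l where "l = K div (2 * m)"
  have K: "int K = \<bar>k\<bar>" "2 * m \<le> K"
    using assms by (auto simp: K_def)
  have "l \<ge> 1"
    using K assms by (simp add: l_def div_greater_zero_iff Suc_le_eq)
  have "2 * m * l \<le> K"
    by (simp add: l_def)
  have "K = 2 * m * l + K mod (2 * m)"
    by (simp add: l_def)
  moreover have "K mod (2 * m) < 2 * m"
    using assms by simp
  moreover have "2 * m \<le> 2 * m * l"
    using \<open>l \<ge> 1\<close> by simp
  ultimately have "K \<le> 4 * m * l"
    by linarith
  then have Kr: "real K \<le> real (4 * m) * real l"
    by (metis of_nat_le_iff of_nat_mult)
  have "line_kernel t k * \<bar>of_int k\<bar> ^ (2 * m) = line_kernel t (int K) * real K ^ (2 * m)"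
    using K by (simp add: line_kernel_abs flip: of_int_abs) (metis of_int_of_nat_eq)
  also have "\<dots> \<le> line_kernel t (2 * int l * int m) * (real (4 * m) * real l) ^ (2 * m)"
  proof (intro mult_mono line_kernel_antimono power_mono line_kernel_nonneg)
    have "int (2 * m * l) \<le> int K"
      using \<open>2 * m * l \<le> K\<close> by (simp only: of_nat_le_iff)
    then show "2 * int l * int m \<le> int K"
      by (simp add: mult_ac)
  qed (use assms Kr in auto)
  also have "\<dots> = real (4 * m) ^ (2 * m) * (line_kernel t (2 * int l * int m) * real l ^ (2 * m))"
    by (simp add: power_mult_distrib)
  also have "\<dots> \<le> real (4 * m) ^ (2 * m) * (t ^ m * line_kernel t 0)"
    using line_kernel_iterate[OF \<open>0 \<le> t\<close>] by (intro mult_left_mono) auto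
  finally show ?thesis
    by (simp add: mult.assoc)
qed

text \<open>In the recurrence at |k| >= 1 the bracket is at most 1. This one factor \<open>t\<close>
  will offset the singularity of the weight in the time integral at 0.\<close>

lemma line_kernel_le_time:
  assumes "0 \<le> t" "k \<noteq> 0"
  shows "line_kernel t k \<le> t"
proof -
  have "line_kernel t \<bar>k\<bar> \<le> of_int \<bar>k\<bar> * line_kernel t \<bar>k\<bar>"
    using assms mult_right_mono[of 1 "of_int \<bar>k\<bar>" "line_kernel t \<bar>k\<bar>"] line_kernel_nonneg[of t]
    by (simp flip: of_int_abs)
  also have "\<dots> = t * (line_kernel t (\<bar>k\<bar> - 1) - line_kernel t (\<bar>k\<bar> + 1))"
    by (rule line_kernel_index_mult)
  also have "\<dots> \<le> t * 1"
    using assms line_kernel_le_1[of t "\<bar>k\<bar> - 1"] line_kernel_nonneg[of t "\<bar>k\<bar> + 1"]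
    by (intro mult_left_mono) auto
  finally show ?thesis
    by (simp add: line_kernel_abs)
qed

text \<open>Far out, \<open>t ^ m\<close> is weakened to \<open>t\<close>. Within distance 2m the
  power of |k| is absorbed by the constant and \<open>line_kernel_le_time\<close> supplies the
  factor \<open>t\<close>.\<close>

lemma line_kernel_tail_small_time:
  assumes "0 \<le> t" "t \<le> 1" "0 < m" "k \<noteq> 0"
  shows "line_kernel t k * \<bar>of_int k\<bar> ^ (2 * m) \<le> real (4 * m) ^ (2 * m) * t"
proof (cases "2 * int m \<le> \<bar>k\<bar>")
  case True
  have "t ^ m * line_kernel t 0 \<le> t * 1"
    using assms line_kernel_le_1[of t 0] line_kernel_nonneg[of t 0] power_decreasing[of 1 m t]
    by (intro mult_mono) auto
  then have "real (4 * m) ^ (2 * m) * (t ^ m * line_kernel t 0) \<le> real (4 * m) ^ (2 * m) * t"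
    by (intro mult_left_mono) auto
  with line_kernel_tail[OF \<open>0 \<le> t\<close> \<open>0 < m\<close> True] show ?thesis
    unfolding mult.assoc by (rule order_trans)
next
  case False
  then have "\<bar>k\<bar> \<le> int (4 * m)"
    by simp
  then have "\<bar>real_of_int k\<bar> \<le> real (4 * m)"
    by linarith
  then have "line_kernel t k * \<bar>of_int k\<bar> ^ (2 * m) \<le> t * real (4 * m) ^ (2 * m)"
    using assms by (intro mult_mono line_kernel_le_time power_mono) auto
  then show ?thesis
    by (simp add: mult.commute)
qed

text \<open>Within distance 2m, \<open>t ^ m\<close> is at least 1, so the on-diagonal bound alone
  suffices there.\<close>

lemma line_kernel_tail_large_time:
  assumes "1 \<le> t" "0 < m"
  shows "line_kernel t k * \<bar>of_int k\<bar> ^ (2 * m) \<le> real (4 * m) ^ (2 * m) * t ^ m / sqrt t"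
proof -
  have z: "line_kernel t 0 \<le> 1 / sqrt t"
    using assms by (intro line_kernel_zero_le) auto
  show ?thesis
  proof (cases "2 * int m \<le> \<bar>k\<bar>")
    case True
    have "real (4 * m) ^ (2 * m) * t ^ m * line_kernel t 0 \<le> real (4 * m) ^ (2 * m) * t ^ m * (1 / sqrt t)"
      using assms z by (intro mult_left_mono) auto
    then show ?thesis
      using line_kernel_tail[of t m k] True assms by simp
  next
    case False
    then have "\<bar>k\<bar> \<le> int (4 * m)"
      by simp
    then have k: "\<bar>real_of_int k\<bar> \<le> real (4 * m)"
      by linarith
    have "line_kernel t k \<le> line_kernel t 0"
      using line_kernel_antimono[of t 0 "\<bar>k\<bar>"] assms by (simp add: line_kernel_abs)
    then have "line_kernel t k * \<bar>of_int k\<bar> ^ (2 * m) \<le> (1 / sqrt t) * real (4 * m) ^ (2 * m)"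
      using assms z k by (intro mult_mono power_mono) auto
    also have "\<dots> \<le> (t ^ m / sqrt t) * real (4 * m) ^ (2 * m)"
      using assms by (intro mult_right_mono divide_right_mono one_le_power) auto
    finally show ?thesis
      by (simp add: mult.commute)
  qed
qed

section \<open>The heat kernel of the lattice\<close>

definition lattice_kernel :: "real \<Rightarrow> int ^ 'd \<Rightarrow> real" where
  "lattice_kernel t z = (\<Prod>i\<in>UNIV. line_kernel t (z $ i))"

definition l1_norm :: "int ^ 'd \<Rightarrow> nat" where
  "l1_norm z = (\<Sum>i\<in>UNIV. nat \<bar>z $ i\<bar>)"

lemma l1_norm_eq_0_iff: "l1_norm z = 0 \<longleftrightarrow> z = 0"
  by (auto simp: l1_norm_def vec_eq_iff)

text \<open>The witness is a coordinate of largest modulus; through it, decay of a single factor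
  controls the whole product.\<close>

lemma l1_norm_le_coordinate:
  fixes z :: "int ^ 'd"
  obtains i where "real (l1_norm z) \<le> real CARD('d) * \<bar>of_int (z $ i)\<bar>"
proof -
  define M where "M = Max (range (\<lambda>i. nat \<bar>z $ i\<bar>))"
  have "M \<in> range (\<lambda>i. nat \<bar>z $ i\<bar>)"
    unfolding M_def by (rule Max_in) auto
  then obtain i where i: "M = nat \<bar>z $ i\<bar>"
    by auto
  have "l1_norm z \<le> CARD('d) * M"
    using sum_bounded_above[of UNIV "\<lambda>i. nat \<bar>z $ i\<bar>" M] by (simp add: l1_norm_def M_def)
  then have "real (l1_norm z) \<le> real (CARD('d) * M)"
    by (simp only: of_nat_le_iff)
  then show ?thesis
    by (intro that[of i]) (simp add: i)
qed

lemma lattice_kernel_nonneg: "0 \<le> t \<Longrightarrow> 0 \<le> lattice_kernel t z"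
  unfolding lattice_kernel_def by (intro prod_nonneg) (simp add: line_kernel_nonneg)

lemma lattice_kernel_le_1: "0 \<le> t \<Longrightarrow> lattice_kernel t z \<le> 1"
  unfolding lattice_kernel_def by (intro prod_le_1) (simp add: line_kernel_nonneg line_kernel_le_1)

lemma line_kernel_le_sqrt:
  assumes "0 < t"
  shows "line_kernel t k \<le> 1 / sqrt t"
  using line_kernel_antimono[of t 0 "\<bar>k\<bar>"] line_kernel_zero_le[OF assms] assms
  by (simp add: line_kernel_abs)

lemma lattice_kernel_remove:
  "lattice_kernel t z = line_kernel t (z $ i) * (\<Prod>j\<in>UNIV - {i}. line_kernel t (z $ j))"
  unfolding lattice_kernel_def by (rule prod.remove) auto

lemma lattice_kernel_le_sqrt:
  fixes z :: "int ^ 'd"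
  assumes "0 < t"
  shows "lattice_kernel t z \<le> (1 / sqrt t) ^ CARD('d)"
  unfolding lattice_kernel_def
  using prod_mono[of UNIV "\<lambda>i. line_kernel t (z $ i)" "\<lambda>_. 1 / sqrt t"] assms
  by (simp add: line_kernel_le_sqrt line_kernel_nonneg)

text \<open>The largest coordinate, nonzero since \<open>z\<close> is, supplies all the spatial
  decay; the other d - 1 factors are merely bounded by \<open>B\<close>.\<close>

lemma lattice_kernel_tail_from_coordinate:
  fixes z :: "int ^ 'd"
  assumes "0 \<le> t" and line: "\<And>k. k \<noteq> 0 \<Longrightarrow> line_kernel t k * \<bar>of_int k\<bar> ^ n \<le> A"
    and B: "\<And>k. line_kernel t k \<le> B" and "z \<noteq> 0"
  shows "lattice_kernel t z * real (l1_norm z) ^ n \<le> real CARD('d) ^ n * (A * B ^ (CARD('d) - 1))"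
proof -
  obtain i where i: "real (l1_norm z) \<le> real CARD('d) * \<bar>of_int (z $ i)\<bar>"
    by (rule l1_norm_le_coordinate)
  have "z $ i \<noteq> 0"
    using i l1_norm_eq_0_iff[of z] \<open>z \<noteq> 0\<close> by auto
  have "(\<Prod>j\<in>UNIV - {i}. line_kernel t (z $ j)) \<le> (\<Prod>j\<in>UNIV - {i}. B)"
    using assms by (intro prod_mono) (auto simp: line_kernel_nonneg)
  also have "\<dots> = B ^ (CARD('d) - 1)"
    by (simp add: card_Diff_singleton)
  finally have P: "(\<Prod>j\<in>UNIV - {i}. line_kernel t (z $ j)) \<le> B ^ (CARD('d) - 1)" .
  have "lattice_kernel t z * real (l1_norm z) ^ n
      \<le> lattice_kernel t z * (real CARD('d) * \<bar>of_int (z $ i)\<bar>) ^ n"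
    using i assms by (intro mult_left_mono power_mono lattice_kernel_nonneg) auto
  also have "\<dots> = real CARD('d) ^ n * ((line_kernel t (z $ i) * \<bar>of_int (z $ i)\<bar> ^ n)
      * (\<Prod>j\<in>UNIV - {i}. line_kernel t (z $ j)))"
    by (simp add: lattice_kernel_remove[of t z i] power_mult_distrib)
  \<comment> \<open>Multiplying the two bounds needs \<open>A\<close> nonnegative, which holds
    because \<open>A\<close> dominates a nonnegative product.\<close>
  also have "\<dots> \<le> real CARD('d) ^ n * (A * B ^ (CARD('d) - 1))"
    using line[OF \<open>z $ i \<noteq> 0\<close>] P line_kernel_nonneg[OF \<open>0 \<le> t\<close>]
      order_trans[OF _ line[OF \<open>z $ i \<noteq> 0\<close>], of 0]
    by (intro mult_left_mono mult_mono prod_nonneg) auto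
  finally show ?thesis .
qed

lemma lattice_kernel_tail_small_time:
  fixes z :: "int ^ 'd"
  assumes "0 \<le> t" "t \<le> 1" "0 < m" "z \<noteq> 0"
  shows "lattice_kernel t z * real (l1_norm z) ^ (2 * m) \<le> real (4 * m * CARD('d)) ^ (2 * m) * t"
  using lattice_kernel_tail_from_coordinate[OF \<open>0 \<le> t\<close> line_kernel_tail_small_time[OF assms(1-3)]
      line_kernel_le_1[OF \<open>0 \<le> t\<close>] \<open>z \<noteq> 0\<close>]
  by (simp add: power_mult_distrib mult_ac)

lemma lattice_kernel_tail_large_time:
  fixes z :: "int ^ 'd"
  assumes "1 \<le> t" "0 < m" "z \<noteq> 0"
  shows "lattice_kernel t z * real (l1_norm z) ^ (2 * m)
    \<le> real (4 * m * CARD('d)) ^ (2 * m) * t ^ m * (1 / sqrt t) ^ CARD('d)"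
proof -
  have "0 < t" "0 \<le> t"
    using assms by auto
  \<comment> \<open>One factor comes from the decaying coordinate, the remaining d - 1 from the
    uniform bound on the others.\<close>
  have "(1 / sqrt t) ^ CARD('d) = (1 / sqrt t) * (1 / sqrt t) ^ (CARD('d) - 1)"
    by (simp flip: power_Suc)
  then show ?thesis
    using lattice_kernel_tail_from_coordinate[OF \<open>0 \<le> t\<close> line_kernel_tail_large_time[OF assms(1,2)]
      line_kernel_le_sqrt[OF \<open>0 < t\<close>] \<open>z \<noteq> 0\<close>]
    by (simp add: power_mult_distrib mult_ac)
qed

lemma lattice_kernel_has_sum:
  assumes "0 \<le> t"
  shows "(lattice_kernel t has_sum 1) (UNIV :: (int ^ 'd) set)"
proof -
  let ?P = "Pi\<^sub>E (UNIV :: 'd set) (\<lambda>_. UNIV :: int set)"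
  have s: "line_kernel t summable_on UNIV" and i: "infsum (line_kernel t) UNIV = 1"
    using line_kernel_has_sum[OF assms] by (auto intro: has_sum_imp_summable infsumI)
  have a: "(\<lambda>k. norm (line_kernel t k)) summable_on UNIV"
    using s assms by (simp add: line_kernel_nonneg)
  have "infsum (\<lambda>g. \<Prod>x\<in>UNIV. line_kernel t (g x)) ?P = (\<Prod>x\<in>(UNIV :: 'd set). infsum (line_kernel t) UNIV)"
    by (rule infsum_prod_PiE_abs) (use a in auto)
  then have I: "infsum (\<lambda>g. \<Prod>x\<in>UNIV. line_kernel t (g x)) ?P = 1"
    by (simp add: i)
  \<comment> \<open>A divergent \<open>infsum\<close> has the default value 0, so the value 1
    certifies convergence.\<close>
  then have "((\<lambda>g. \<Prod>x\<in>UNIV. line_kernel t (g x)) has_sum 1) ?P"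
    by (metis has_sum_infsum infsum_not_exists zero_neq_one)
  moreover have "bij_betw (vec_nth :: int ^ 'd \<Rightarrow> _) UNIV ?P"
    by (rule bij_betwI[where g = vec_lambda]) auto
  ultimately show ?thesis
    by (simp add: has_sum_reindex_bij_betw[symmetric] lattice_kernel_def[abs_def])
qed

section \<open>The product kernel solves the heat equation\<close>

lemma neighbours_eq:
  "{y. lattice_adj x y} = range (\<lambda>i. x - axis i 1) \<union> range (\<lambda>i. x + axis i 1)"
proof -
  have "x - y = axis i 1 \<longleftrightarrow> y = x - axis i 1" "x - y = - axis i 1 \<longleftrightarrow> y = x + axis i 1" for y i
    by (auto simp: algebra_simps)
  then show ?thesis
    unfolding lattice_adj_def by auto
qed

text \<open>Ensures that \<open>sum_neighbours\<close> counts 2d distinct neighbours.\<close>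

lemma axis_one_neq_minus: "- axis i (1::int) \<noteq> axis j 1"
proof
  assume "- axis i (1::int) = axis j 1"
  then have "(- axis i (1::int)) $ i = axis j 1 $ i"
    by simp
  then show False
    by (simp add: axis_def split: if_splits)
qed

lemma sum_neighbours:
  "(\<Sum>y | lattice_adj x y. g y) = (\<Sum>i\<in>UNIV. g (x - axis i 1) + g (x + axis i 1))"
proof -
  have "(\<Sum>y | lattice_adj x y. g y) =
      sum g (range (\<lambda>i. x - axis i 1)) + sum g (range (\<lambda>i. x + axis i 1))"
    unfolding neighbours_eq
    by (intro sum.union_disjoint) (auto simp: axis_one_neq_minus)
  also have "\<dots> = (\<Sum>i\<in>UNIV. g (x - axis i 1)) + (\<Sum>i\<in>UNIV. g (x + axis i 1))"
    by (simp add: sum.reindex inj_on_def axis_eq_axis)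
  finally show ?thesis
    by (simp add: sum.distrib)
qed

lemma lattice_kernel_shift:
  "lattice_kernel t (z + axis i k) = line_kernel t (z $ i + k) * (\<Prod>j\<in>UNIV - {i}. line_kernel t (z $ j))"
  unfolding lattice_kernel_remove[of t "z + axis i k" i]
  by (intro arg_cong2[where f = "(*)"] prod.cong) (auto simp: axis_def)

text \<open>In the product rule, differentiating factor \<open>i\<close> produces the second
  difference in direction \<open>i\<close>; by \<open>lattice_kernel_shift\<close> this is the
  contribution of the two neighbours along that axis.\<close>

lemma lattice_kernel_bounded_heat_solution:
  "bounded_heat_solution y (\<lambda>t x. lattice_kernel t (x - y))"
  unfolding bounded_heat_solution_def
proof (intro conjI allI impI exI[of _ 1])
  fix t :: real and x
  assume "0 \<le> t"
  then show "\<bar>lattice_kernel t (x - y)\<bar> \<le> 1"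
    by (simp add: lattice_kernel_nonneg lattice_kernel_le_1)
next
  fix x
  show "lattice_kernel 0 (x - y) = (if x = y then 1 else 0)"
    by (auto simp: lattice_kernel_def line_kernel_0 vec_eq_iff)
next
  fix t :: real and x
  let ?z = "x - y"
  let ?R = "\<lambda>i. \<Prod>j\<in>UNIV - {i}. line_kernel t (?z $ j)"
  have "((\<lambda>s. lattice_kernel s ?z) has_real_derivative
     (\<Sum>i\<in>UNIV. (line_kernel t (?z $ i - 1) - 2 * line_kernel t (?z $ i) + line_kernel t (?z $ i + 1)) * ?R i)) (at t)"
    unfolding lattice_kernel_def by (intro has_field_derivative_prod line_kernel_deriv)
  moreover have "(line_kernel t (?z $ i - 1) - 2 * line_kernel t (?z $ i) + line_kernel t (?z $ i + 1)) * ?R i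
      = (lattice_kernel t (x - axis i 1 - y) - lattice_kernel t ?z) + (lattice_kernel t (x + axis i 1 - y) - lattice_kernel t ?z)" for i
  proof -
    have "x - axis i 1 - y = ?z + axis i (- 1)" "x + axis i 1 - y = ?z + axis i 1"
      by (simp_all add: vec_eq_iff axis_def)
    then show ?thesis
      by (simp only: lattice_kernel_shift lattice_kernel_remove[of t ?z i]) (simp add: algebra_simps)
  qed
  ultimately have "((\<lambda>s. lattice_kernel s ?z) has_real_derivative
      lattice_laplacian (\<lambda>x. lattice_kernel t (x - y)) x) (at t)"
    by (simp add: lattice_laplacian_def sum_neighbours)
  then show "((\<lambda>s. lattice_kernel s (x - y)) has_real_derivative
      lattice_laplacian (\<lambda>x. lattice_kernel t (x - y)) x) (at t within {0..})"
    by (rule has_field_derivative_at_within)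
qed

section \<open>Uniqueness of bounded solutions\<close>

lemma abs_le_power_if_deriv_le_power:
  fixes f :: "real \<Rightarrow> real"
  assumes "0 \<le> t" "f 0 = 0"
    and deriv: "\<And>s. 0 \<le> s \<Longrightarrow> (f has_real_derivative f' s) (at s within {0..})"
    and bound: "\<And>s. 0 \<le> s \<Longrightarrow> \<bar>f' s\<bar> \<le> K * s ^ n"
  shows "\<bar>f t\<bar> \<le> K * t ^ Suc n / real (Suc n)"
proof -
  let ?g = "\<lambda>s. K * s ^ Suc n / real (Suc n)"
  have cont: "continuous_on {0..t} f"
  proof (rule continuous_on_subset)
    show "continuous_on {0..} f"
      by (rule DERIV_continuous_on[where D = f']) (simp add: deriv)
  qed auto
  have D: "(?g has_real_derivative K * s ^ n) (at s)" for s
    using DERIV_cdivide[OF DERIV_cmult[OF DERIV_pow[of "Suc n" s UNIV]], of K "real (Suc n)"]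
    by (simp del: of_nat_Suc power_Suc)
  have F: "(f has_real_derivative f' s) (at s)" if "0 < s" for s
    using deriv[of s] that at_within_interior[of s "{0..}"] by simp
  \<comment> \<open>\<open>?g\<close> is an antiderivative of the bound, so \<open>?g + f\<close>
    and \<open>?g - f\<close> both increase. Derivatives at interior points and continuity suffice,
    which accommodates the one-sided derivative at 0 and asks no integrability of
    \<open>f'\<close>.\<close>
  have "?g 0 + f 0 \<le> ?g t + f t"
  proof (rule DERIV_nonneg_imp_increasing_open[OF \<open>0 \<le> t\<close>])
    show "\<exists>y. ((\<lambda>s. ?g s + f s) has_real_derivative y) (at s) \<and> 0 \<le> y" if "0 < s" for s
      using DERIV_add[OF D F[OF that]] bound[of s] that by (intro exI[of _ "K * s ^ n + f' s"]) auto
  qed (intro continuous_intros cont, auto)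
  moreover have "?g 0 - f 0 \<le> ?g t - f t"
  proof (rule DERIV_nonneg_imp_increasing_open[OF \<open>0 \<le> t\<close>])
    show "\<exists>y. ((\<lambda>s. ?g s - f s) has_real_derivative y) (at s) \<and> 0 \<le> y" if "0 < s" for s
      using DERIV_diff[OF D F[OF that]] bound[of s] that by (intro exI[of _ "K * s ^ n - f' s"]) auto
  qed (intro continuous_intros cont, auto)
  ultimately show ?thesis
    using \<open>f 0 = 0\<close> by auto
qed

text \<open>There are 2d neighbours, and each difference is at most 2K in modulus.\<close>

lemma lattice_laplacian_abs_le:
  fixes x :: "int ^ 'd"
  assumes "\<And>y. \<bar>f y\<bar> \<le> K"
  shows "\<bar>lattice_laplacian f x\<bar> \<le> 4 * real CARD('d) * K"
proof -
  have "\<bar>lattice_laplacian f x\<bar> \<le> (\<Sum>i\<in>(UNIV :: 'd set). 4 * K)"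
    unfolding lattice_laplacian_def sum_neighbours
  proof (rule sum_norm_le[where 'a = real, unfolded real_norm_def])
    fix i
    show "\<bar>f (x - axis i 1) - f x + (f (x + axis i 1) - f x)\<bar> \<le> 4 * K"
      using assms[of x] assms[of "x - axis i 1"] assms[of "x + axis i 1"] by linarith
  qed
  then show ?thesis
    by simp
qed

text \<open>The Laplacian is a bounded operator on bounded functions. Feeding a uniform bound on the
  difference back into the equation \<open>n\<close> times improves it to (A + B) (Lt)^n / n!, which
  tends to 0.\<close>

lemma bounded_heat_solution_unique:
  fixes x y :: "int ^ 'd"
  assumes v: "bounded_heat_solution y v" and w: "bounded_heat_solution y w" and "0 \<le> t"
  shows "v t x = w t x"
proof -
  define g where "g t x = v t x - w t x" for t x
  define L where "L = 4 * real CARD('d)"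
  obtain A where A: "\<bar>v t x\<bar> \<le> A" if "0 \<le> t" for t x
    using v unfolding bounded_heat_solution_def by blast
  obtain B where B: "\<bar>w t x\<bar> \<le> B" if "0 \<le> t" for t x
    using w unfolding bounded_heat_solution_def by blast
  have g0: "g 0 x = 0" for x
    using v w by (simp add: g_def bounded_heat_solution_def)
  have deriv: "((\<lambda>s. g s x) has_real_derivative lattice_laplacian (g s) x) (at s within {0..})"
    if "0 \<le> s" for s x
  proof -
    have "lattice_laplacian (g s) x = lattice_laplacian (v s) x - lattice_laplacian (w s) x"
      by (simp add: lattice_laplacian_def g_def algebra_simps sum_subtractf sum.distrib)
    then show ?thesis
      using v w that unfolding g_def bounded_heat_solution_def by (auto intro!: derivative_intros)
  qed
  have bound: "\<bar>g t x\<bar> \<le> (A + B) * ((L * t) ^ n / fact n)" if "0 \<le> t" for t x n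
    using that
  proof (induction n arbitrary: t x)
    case 0
    then show ?case
      using A[of t x] B[of t x] by (simp add: g_def)
  next
    case (Suc n)
    let ?K = "L * ((A + B) * (L ^ n / fact n))"
    have "\<bar>g t x\<bar> \<le> ?K * t ^ Suc n / real (Suc n)"
    proof (rule abs_le_power_if_deriv_le_power[OF Suc.prems g0 deriv])
      fix s :: real
      assume "0 \<le> s"
      then have "\<bar>lattice_laplacian (g s) x\<bar> \<le> L * ((A + B) * ((L * s) ^ n / fact n))"
        unfolding L_def by (intro lattice_laplacian_abs_le Suc.IH[unfolded L_def])
      then show "\<bar>lattice_laplacian (g s) x\<bar> \<le> ?K * s ^ n"
        by (simp add: power_mult_distrib mult_ac)
    qed auto
    then show ?case
      by (simp add: power_mult_distrib mult_ac)
  qed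
  have "(\<lambda>n. (A + B) * ((L * t) ^ n / fact n)) \<longlonglongrightarrow> (A + B) * 0"
    using summable_LIMSEQ_zero[OF summable_exp_generic[of "L * t"]]
    by (intro tendsto_mult tendsto_const) (simp add: divide_inverse_commute)
  then have "\<bar>g t x\<bar> \<le> (A + B) * 0"
    by (rule LIMSEQ_le_const) (use bound[OF \<open>0 \<le> t\<close>] in auto)
  then show ?thesis
    by (simp add: g_def)
qed

lemma heat_kernel_eq:
  assumes "0 \<le> t"
  shows "heat_kernel t x y = lattice_kernel t (x - y)"
  unfolding heat_kernel_def
proof (rule the_equality)
  show "\<exists>v. bounded_heat_solution y v \<and> lattice_kernel t (x - y) = v t x"
    using lattice_kernel_bounded_heat_solution by blast
  show "p = lattice_kernel t (x - y)" if "\<exists>v. bounded_heat_solution y v \<and> p = v t x" for p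
    using that bounded_heat_solution_unique[OF _ lattice_kernel_bounded_heat_solution assms] by blast
qed

section \<open>Graph distance against the l1 norm\<close>

lemma walk_of_length_l1_norm:
  "(lattice_adj ^^ l1_norm (x - y)) x y"
proof (induction "l1_norm (x - y)" arbitrary: x)
  case 0
  then have "x = y"
    using l1_norm_eq_0_iff[of "x - y"] by auto
  then show ?case
    by (simp add: l1_norm_def)
next
  case (Suc n)
  then have "x - y \<noteq> 0"
    using l1_norm_eq_0_iff[of "x - y"] by auto
  then obtain i where i: "(x - y) $ i \<noteq> 0"
    by (auto simp: vec_eq_iff)
  \<comment> \<open>One step towards \<open>y\<close> along a coordinate where they differ lowers
    the norm by exactly one.\<close>
  define x' where "x' = x - axis i (sgn ((x - y) $ i))"
  have "l1_norm (x - y) = nat \<bar>(x - y) $ i\<bar> + (\<Sum>j\<in>UNIV - {i}. nat \<bar>(x - y) $ j\<bar>)"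
    unfolding l1_norm_def by (rule sum.remove) auto
  moreover have "l1_norm (x' - y) = nat \<bar>(x' - y) $ i\<bar> + (\<Sum>j\<in>UNIV - {i}. nat \<bar>(x' - y) $ j\<bar>)"
    unfolding l1_norm_def by (rule sum.remove) auto
  moreover have "(\<Sum>j\<in>UNIV - {i}. nat \<bar>(x' - y) $ j\<bar>) = (\<Sum>j\<in>UNIV - {i}. nat \<bar>(x - y) $ j\<bar>)"
    by (rule sum.cong) (auto simp: x'_def axis_def)
  moreover have "nat \<bar>(x - y) $ i\<bar> = Suc (nat \<bar>(x' - y) $ i\<bar>)"
    using i by (auto simp: x'_def axis_def sgn_if)
  ultimately have "n = l1_norm (x' - y)"
    using Suc(2) by simp
  have "lattice_adj x x'"
    using i unfolding lattice_adj_def x'_def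
    by (intro exI[of _ i]) (auto simp: sgn_if axis_def vec_eq_iff)
  then have "(lattice_adj ^^ Suc n) x y"
    using Suc(1)[OF \<open>n = l1_norm (x' - y)\<close>] unfolding \<open>n = l1_norm (x' - y)\<close>
    by (rule relpowp_Suc_I2)
  then show ?case
    by (simp only: Suc(2))
qed

text \<open>The direction that transfers the hypothesis on \<open>u\<close> to weights in
  \<open>l1_norm\<close>: a smaller distance means a larger weight.\<close>

lemma lattice_dist_le_l1_norm: "lattice_dist x y \<le> l1_norm (x - y)"
  unfolding lattice_dist_def by (rule Least_le) (rule walk_of_length_l1_norm)

text \<open>Since a walk exists, the least length is attained, and a walk of length 0 joins only
  equal points. Positivity makes negative powers of the distance antitone.\<close>

lemma lattice_dist_pos:
  assumes "x \<noteq> y"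
  shows "0 < lattice_dist x y"
proof (rule ccontr)
  assume "\<not> 0 < lattice_dist x y"
  moreover have "(lattice_adj ^^ lattice_dist x y) x y"
    unfolding lattice_dist_def by (rule LeastI) (rule walk_of_length_l1_norm)
  ultimately show False
    using assms by simp
qed

section \<open>Time integrals and the fractional Laplacian\<close>

lemma has_bochner_integral_lborel_if_has_integral:
  fixes f :: "real \<Rightarrow> real"
  assumes "f \<in> borel_measurable borel" "S \<in> sets borel" "\<And>x. x \<in> S \<Longrightarrow> 0 \<le> f x" "(f has_integral I) S"
  shows "has_bochner_integral lborel (\<lambda>x. indicator S x * f x) I"
proof (rule has_bochner_integral_nn_integral)
  show "0 \<le> I"
    using assms by (intro has_integral_nonneg[OF assms(4)]) auto
  show "(\<integral>\<^sup>+ x. ennreal (indicator S x * f x) \<partial>lborel) = ennreal I"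
    using assms by (intro nn_integral_has_integral_lebesgue)
qed (use assms in \<open>auto simp: indicator_def\<close>)

text \<open>Fubini for a series over a countably infinite index type, reduced to sequences by an
  enumeration \<open>e\<close>.\<close>

lemma
  fixes f :: "'i :: countable \<Rightarrow> 'a \<Rightarrow> 'b :: {banach, second_countable_topology}"
  assumes "infinite (UNIV :: 'i set)"
    and int: "\<And>i. integrable M (f i)"
    and sum: "\<And>t. t \<in> space M \<Longrightarrow> (\<lambda>i. norm (f i t)) summable_on UNIV"
    and sum_int: "(\<lambda>i. \<integral>t. norm (f i t) \<partial>M) summable_on UNIV"
  shows integrable_infsum: "integrable M (\<lambda>t. \<Sum>\<^sub>\<infinity>i. f i t)"
    and has_sum_integral: "((\<lambda>i. \<integral>t. f i t \<partial>M) has_sum (\<integral>t. (\<Sum>\<^sub>\<infinity>i. f i t) \<partial>M)) UNIV"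
proof -
  define e where "e = from_nat_into (UNIV :: 'i set)"
  have e: "bij_betw e UNIV UNIV"
    unfolding e_def using assms(1) by (intro bij_betw_from_nat_into) auto
  have s: "summable (\<lambda>n. norm (f (e n) t))" if "t \<in> space M" for t
    using sum[OF that] by (intro summable_on_imp_summable)
      (simp add: summable_on_reindex_bij_betw[OF e, of "\<lambda>i. norm (f i t)"])
  have s_int: "summable (\<lambda>n. \<integral>t. norm (f (e n) t) \<partial>M)"
    using sum_int by (intro summable_on_imp_summable)
      (simp add: summable_on_reindex_bij_betw[OF e, of "\<lambda>i. \<integral>t. norm (f i t) \<partial>M"])
  have eq: "(\<Sum>n. f (e n) t) = (\<Sum>\<^sub>\<infinity>i. f i t)" if "t \<in> space M" for t
  proof -
    have "((\<lambda>i. f i t) has_sum (\<Sum>\<^sub>\<infinity>i. f i t)) UNIV"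
      using abs_summable_summable[OF sum[OF that]] by simp
    then have "((\<lambda>n. f (e n) t) has_sum (\<Sum>\<^sub>\<infinity>i. f i t)) UNIV"
      by (subst has_sum_reindex_bij_betw[OF e])
    then show ?thesis
      using has_sum_imp_sums sums_unique by metis
  qed
  have "integrable M (\<lambda>t. \<Sum>n. f (e n) t)"
    by (rule integrable_suminf[OF int _ s_int]) (simp add: s)
  then show "integrable M (\<lambda>t. \<Sum>\<^sub>\<infinity>i. f i t)"
    by (subst (asm) Bochner_Integration.integrable_cong[OF refl eq])
  have "(\<lambda>n. \<integral>t. f (e n) t \<partial>M) sums (\<integral>t. (\<Sum>n. f (e n) t) \<partial>M)"
    by (rule sums_integral[OF int _ s_int]) (simp add: s)
  then have "(\<lambda>n. \<integral>t. f (e n) t \<partial>M) sums (\<integral>t. (\<Sum>\<^sub>\<infinity>i. f i t) \<partial>M)"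
    by (subst (asm) Bochner_Integration.integral_cong[OF refl eq])
  \<comment> \<open>\<open>sums\<close> depends on the order of the terms; absolute convergence
    upgrades it to \<open>has_sum\<close>, which can be carried back along \<open>e\<close>.\<close>
  moreover have "summable (\<lambda>n. norm (\<integral>t. f (e n) t \<partial>M))"
    by (rule summable_comparison_test'[OF s_int]) simp
  ultimately have "((\<lambda>n. \<integral>t. f (e n) t \<partial>M) has_sum (\<integral>t. (\<Sum>\<^sub>\<infinity>i. f i t) \<partial>M)) UNIV"
    by (intro norm_summable_imp_has_sum)
  then show "((\<lambda>i. \<integral>t. f i t \<partial>M) has_sum (\<integral>t. (\<Sum>\<^sub>\<infinity>i. f i t) \<partial>M)) UNIV"
    by (subst (asm) has_sum_reindex_bij_betw[OF e])
qed

section \<open>Decay and time integral of the lattice kernel\<close>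

lemma continuous_on_lattice_kernel: "continuous_on UNIV (\<lambda>t. lattice_kernel t z)"
  unfolding lattice_kernel_def
  by (intro continuous_intros DERIV_continuous_on[OF line_kernel_deriv[THEN has_field_derivative_at_within]])

lemma lattice_kernel_borel_measurable [measurable]: "(\<lambda>t. lattice_kernel t z) \<in> borel_measurable borel"
  by (rule borel_measurable_continuous_onI) (rule continuous_on_lattice_kernel)

lemma lattice_kernel_decay:
  assumes "0 < t" "\<alpha> < 2"
  obtains C where "0 \<le> C"
    "\<And>z :: int ^ 'd. z \<noteq> 0 \<Longrightarrow> lattice_kernel t z \<le> C * real (l1_norm z) powr - (real CARD('d) + \<alpha>)"
proof -
  \<comment> \<open>Then 2m = 2d + 2 exceeds d + \<alpha>, which suffices because nonzero points
    have norm at least 1.\<close>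
  define m where "m = CARD('d) + 1"
  define C where "C = real (4 * m * CARD('d)) ^ (2 * m) * max t (t ^ m * (1 / sqrt t) ^ CARD('d))"
  have "0 \<le> C"
    unfolding C_def using \<open>0 < t\<close> by (intro mult_nonneg_nonneg) (auto simp: le_max_iff_disj)
  moreover have "lattice_kernel t z \<le> C * real (l1_norm z) powr - (real CARD('d) + \<alpha>)"
    if "z \<noteq> 0" for z :: "int ^ 'd"
  proof -
    define R where "R = real (l1_norm z)"
    have R: "1 \<le> R"
      using l1_norm_eq_0_iff[of z] that by (simp add: R_def)
    have "lattice_kernel t z * R ^ (2 * m) \<le> C"
    proof (cases "t \<le> 1")
      case True
      have "lattice_kernel t z * R ^ (2 * m) \<le> real (4 * m * CARD('d)) ^ (2 * m) * t"
        unfolding R_def using True assms that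
        by (intro lattice_kernel_tail_small_time) (auto simp: m_def)
      also have "\<dots> \<le> C"
        unfolding C_def by (intro mult_left_mono) auto
      finally show ?thesis .
    next
      case False
      have "lattice_kernel t z * R ^ (2 * m) \<le> real (4 * m * CARD('d)) ^ (2 * m) * t ^ m * (1 / sqrt t) ^ CARD('d)"
        unfolding R_def using False that
        by (intro lattice_kernel_tail_large_time) (auto simp: m_def)
      also have "\<dots> \<le> C"
        unfolding C_def mult.assoc by (intro mult_left_mono) auto
      finally show ?thesis .
    qed
    then have "lattice_kernel t z \<le> C * R powr - (2 * real m)"
      using R by (simp add: powr_minus powr_realpow[symmetric] field_simps)
    also have "\<dots> \<le> C * R powr - (real CARD('d) + \<alpha>)"
      using R \<open>0 \<le> C\<close> assms by (intro mult_left_mono powr_mono) (auto simp: m_def)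
    finally show ?thesis
      by (simp add: R_def)
  qed
  ultimately show ?thesis
    using that by blast
qed

text \<open>Time is split at 1 and at R^2, the diffusive time scale of distance R. The last two
  ranges scale exactly as R^(-d-\<alpha>), and the first is no larger in order.\<close>

lemma lattice_kernel_time_integral:
  assumes "0 < \<alpha>" "\<alpha> < 2"
  obtains C where "0 \<le> C"
    "\<And>z :: int ^ 'd. z \<noteq> 0 \<Longrightarrow> set_integrable lborel {0<..} (\<lambda>t. t powr (- 1 - \<alpha> / 2) * lattice_kernel t z)"
    "\<And>z :: int ^ 'd. z \<noteq> 0 \<Longrightarrow> (LBINT t:{0<..}. t powr (- 1 - \<alpha> / 2) * lattice_kernel t z)
        \<le> C * real (l1_norm z) powr - (real CARD('d) + \<alpha>)"
proof -
  define D where "D = real CARD('d)"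
  define m where "m = CARD('d) + 1"
  define K where "K = real (4 * m * CARD('d)) ^ (2 * m)"
  \<comment> \<open>\<open>a\<close>, \<open>b\<close>, \<open>c\<close> are the exponents of
    \<open>t\<close> in the majorant on the three ranges. The choice of \<open>m\<close> gives b =
    (d - \<alpha>)/2 > -1, and \<open>C\<close> collects the factors from integrating the three
    powers.\<close>
  define a where "a = - \<alpha> / 2"
  define b where "b = real m - D / 2 - 1 - \<alpha> / 2"
  define c where "c = - 1 - \<alpha> / 2 - D / 2"
  define C where "C = K / (a + 1) + K / (b + 1) - 1 / (c + 1)"
  have D: "1 \<le> D"
    by (simp add: D_def Suc_le_eq)
  have m: "real m = D + 1" "0 < m"
    by (simp_all add: m_def D_def)
  have abc: "- 1 < a" "- 1 < b" "c < - 1"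
    using assms D m by (auto simp: a_def b_def c_def)
  have "0 \<le> K"
    by (simp add: K_def)
  have "0 \<le> K / (a + 1)" "0 \<le> K / (b + 1)" "1 / (c + 1) \<le> 0"
    using abc \<open>0 \<le> K\<close> by (auto simp: divide_nonpos_nonneg divide_le_0_iff)
  then have "0 \<le> C"
    unfolding C_def by linarith
  have main: "set_integrable lborel {0<..} (\<lambda>t. t powr (- 1 - \<alpha> / 2) * lattice_kernel t z) \<and>
      (LBINT t:{0<..}. t powr (- 1 - \<alpha> / 2) * lattice_kernel t z) \<le> C * real (l1_norm z) powr - (D + \<alpha>)"
    if "z \<noteq> 0" for z :: "int ^ 'd"
  proof -
    define R where "R = real (l1_norm z)"
    have R: "1 \<le> R"
      using l1_norm_eq_0_iff[of z] that by (simp add: R_def)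
    define L where "L = K * R powr - (2 * real m)"
    have "0 \<le> L"
      using \<open>0 \<le> K\<close> by (simp add: L_def)
    let ?f = "\<lambda>t. indicator {0<..} t * (t powr (- 1 - \<alpha> / 2) * lattice_kernel t z)"
    \<comment> \<open>The middle term is extended down to 0, which only enlarges the majorant and
      allows the closed form for a power integrated from 0.\<close>
    let ?h = "\<lambda>t. L * (indicator {0..1} t * t powr a) + L * (indicator {0..R\<^sup>2} t * t powr b)
      + indicator {R\<^sup>2..} t * t powr c"
    let ?I = "L * (1 powr (a + 1) / (a + 1)) + L * ((R\<^sup>2) powr (b + 1) / (b + 1)) + (- ((R\<^sup>2) powr (c + 1)) / (c + 1))"
    have h: "has_bochner_integral lborel ?h ?I"
      using abc R
      by (intro has_bochner_integral_add has_bochner_integral_mult_right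
          has_bochner_integral_lborel_if_has_integral has_integral_powr_from_0 has_integral_powr_to_inf) auto
    have tail: "lattice_kernel t z \<le> L * B" if "lattice_kernel t z * R ^ (2 * m) \<le> K * B" for t B
      using that R by (simp add: L_def powr_minus powr_realpow[symmetric] field_simps)
    have s: "(1 / sqrt t) ^ CARD('d) = t powr (- D / 2)" if "0 < t" for t
      using that by (simp add: D_def powr_half_sqrt[symmetric] powr_realpow[symmetric] powr_powr
          powr_minus_divide[symmetric])
    have le: "?f t \<le> ?h t" for t
    proof -
      consider "t \<le> 0" | "0 < t" "t \<le> 1" | "1 < t" "t \<le> R\<^sup>2" | "1 < t" "R\<^sup>2 < t"
        by linarith
      then show ?thesis
      proof cases
        case 1
        then show ?thesis
          using \<open>0 \<le> L\<close> by (auto intro!: add_nonneg_nonneg)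
      next
        case 2
        have "lattice_kernel t z \<le> L * t"
          using lattice_kernel_tail_small_time[of t m z] 2 m that by (intro tail) (simp add: K_def R_def)
        then have "t powr (- 1 - \<alpha> / 2) * lattice_kernel t z \<le> t powr (- 1 - \<alpha> / 2) * (L * t)"
          by (intro mult_left_mono) auto
        also have "\<dots> = L * (t powr (- 1 - \<alpha> / 2) * t powr 1)"
          using 2 by simp
        also have "\<dots> = L * t powr a"
          unfolding powr_add[symmetric] by (simp add: a_def)
        finally show ?thesis
          using 2 \<open>0 \<le> L\<close> by (auto simp: indicator_def intro!: add_increasing2)
      next
        case 3
        have "lattice_kernel t z \<le> L * (t powr real m * t powr (- D / 2))"
          using lattice_kernel_tail_large_time[of t m z] 3 m(2) that s[of t]
          by (intro tail) (simp add: K_def R_def powr_realpow)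
        then have "t powr (- 1 - \<alpha> / 2) * lattice_kernel t z \<le> t powr (- 1 - \<alpha> / 2) * (L * (t powr real m * t powr (- D / 2)))"
          by (intro mult_left_mono) auto
        also have "\<dots> = L * (t powr (- 1 - \<alpha> / 2) * (t powr real m * t powr (- D / 2)))"
          by simp
        also have "\<dots> = L * t powr b"
          unfolding powr_add[symmetric] by (simp add: b_def algebra_simps)
        finally show ?thesis
          using 3 \<open>0 \<le> L\<close> by (auto simp: indicator_def intro!: add_increasing2)
      next
        case 4
        have "t powr (- 1 - \<alpha> / 2) * lattice_kernel t z \<le> t powr (- 1 - \<alpha> / 2) * t powr (- D / 2)"
          using lattice_kernel_le_sqrt[of t z] 4 s[of t] by (intro mult_left_mono) auto
        also have "\<dots> = t powr c"
          unfolding powr_add[symmetric] by (simp add: c_def)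
        finally show ?thesis
          using 4 by (auto simp: indicator_def)
      qed
    qed
    have f: "integrable lborel ?f"
    proof (rule Bochner_Integration.integrable_bound)
      show "integrable lborel ?h"
        using h by (rule integrable.intros)
      have "0 \<le> ?f t" for t
        by (auto simp: indicator_def lattice_kernel_nonneg)
      then show "AE t in lborel. norm (?f t) \<le> norm (?h t)"
        using le by (auto intro!: AE_I2 simp: abs_of_nonneg order_trans[OF _ abs_ge_self])
    qed measurable
    have "integral\<^sup>L lborel ?f \<le> integral\<^sup>L lborel ?h"
      by (intro integral_mono f integrable.intros[OF h] le)
    also have "\<dots> = ?I"
      by (rule has_bochner_integral_integral_eq[OF h])
    also have "\<dots> \<le> C * R powr - (D + \<alpha>)"
    proof -
      have R2: "R\<^sup>2 = R powr 2"
        using R by simp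
      have 1: "L * (1 powr (a + 1) / (a + 1)) \<le> (K / (a + 1)) * R powr - (D + \<alpha>)"
      proof -
        have "L \<le> K * R powr - (D + \<alpha>)"
          unfolding L_def using R m D assms \<open>0 \<le> K\<close> by (intro mult_left_mono powr_mono) auto
        then show ?thesis
          using abc by (simp add: divide_right_mono)
      qed
      \<comment> \<open>The exponents balance: -2m + 2(b + 1) = -d - \<alpha>. Likewise 2(c + 1) =
        -d - \<alpha> for the last range.\<close>
      have 2: "L * ((R\<^sup>2) powr (b + 1) / (b + 1)) = (K / (b + 1)) * R powr - (D + \<alpha>)"
      proof -
        have "R powr - (2 * real m) * (R\<^sup>2) powr (b + 1) = R powr - (D + \<alpha>)"
          unfolding R2 powr_powr powr_add[symmetric] by (rule arg_cong2[where f = "(powr)"]) (auto simp: b_def)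
        then show ?thesis
          unfolding L_def by (metis (no_types, opaque_lifting) mult.assoc times_divide_eq_left times_divide_eq_right)
      qed
      have 3: "- ((R\<^sup>2) powr (c + 1)) / (c + 1) = - (1 / (c + 1)) * R powr - (D + \<alpha>)"
      proof -
        have "(R\<^sup>2) powr (c + 1) = R powr - (D + \<alpha>)"
          unfolding R2 powr_powr by (rule arg_cong2[where f = "(powr)"]) (auto simp: c_def)
        then show ?thesis
          by simp
      qed
      show ?thesis
        using 1 unfolding 2 3 C_def left_diff_distrib distrib_right by simp
    qed
    finally show ?thesis
      using f by (simp add: set_integrable_def set_lebesgue_integral_def R_def)
  qed
  show ?thesis
    by (rule that[OF \<open>0 \<le> C\<close>]) (use main in \<open>auto simp: D_def\<close>)
qed

section \<open>Termwise integration of the semigroup difference\<close>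

theorem corollary2p7:
  fixes \<alpha> :: real and u :: "int ^ 'd \<Rightarrow> complex"
  assumes "0 < \<alpha>" and "\<alpha> < 2"
    and "\<And>x. (\<lambda>y. norm (u x - u y) / real (lattice_dist x y) powr (real CARD('d) + \<alpha>))
           summable_on (UNIV - {x})"
  shows "\<forall>x.
    (\<forall>t>0. (\<lambda>y. norm (of_real (heat_kernel t x y) * u y)) summable_on UNIV) \<and>
    set_integrable lborel {0<..} (frac_laplacian_integrand \<alpha> u x) \<and>
    ((\<lambda>y. of_real (Q_kernel \<alpha> x y) * (u x - u y)) has_sum frac_laplacian \<alpha> u x) (UNIV - {x})"
proof
  fix x :: "int ^ 'd"
  let ?p = "\<lambda>t y. lattice_kernel t (x - y)"
  let ?w = "\<lambda>t. t powr (- 1 - \<alpha> / 2)"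
  let ?g = "\<lambda>y. real (l1_norm (x - y)) powr - (real CARD('d) + \<alpha>)"
  let ?J = "\<lambda>y. LBINT t:{0<..}. ?w t * ?p t y"
  let ?c = "1 / \<bar>Gamma (- (\<alpha> / 2))\<bar>"
  \<comment> \<open>The diagonal term vanishes with \<open>u x - u x\<close>, so the sum may run
    over the whole lattice.\<close>
  have g: "(\<lambda>y. norm (u x - u y) * ?g y) summable_on UNIV"
  proof -
    have "(\<lambda>y. norm (u x - u y) * ?g y) summable_on UNIV - {x}"
    proof (rule summable_on_comparison_test)
      show "(\<lambda>y. norm (u x - u y) / real (lattice_dist x y) powr (real CARD('d) + \<alpha>)) summable_on (UNIV - {x})"
        by (rule assms)
      fix y
      assume "y \<in> UNIV - {x}"
      then have "?g y \<le> real (lattice_dist x y) powr - (real CARD('d) + \<alpha>)"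
        using assms(1) lattice_dist_pos[of x y] lattice_dist_le_l1_norm[of x y]
        by (intro powr_mono2') auto
      from mult_left_mono[OF this, of "norm (u x - u y)"]
      show "norm (u x - u y) * ?g y \<le> norm (u x - u y) / real (lattice_dist x y) powr (real CARD('d) + \<alpha>)"
        unfolding powr_minus by (simp add: divide_inverse)
    qed auto
    then show ?thesis
      by (rule summable_on_cong_neutral[THEN iffD1, rotated 3]) auto
  qed
  have weighted: "(\<lambda>y. ?p t y * norm (u x - u y)) summable_on UNIV" if "0 < t" for t
  proof -
    obtain A where A: "0 \<le> A"
      "\<And>z :: int ^ 'd. z \<noteq> 0 \<Longrightarrow> lattice_kernel t z \<le> A * real (l1_norm z) powr - (real CARD('d) + \<alpha>)"
      using lattice_kernel_decay[OF \<open>0 < t\<close> \<open>\<alpha> < 2\<close>, where ?'d = 'd] by blast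
    show ?thesis
    proof (rule summable_on_comparison_test[OF summable_on_cmult_right[OF g, of A]])
      fix y
      show "?p t y * norm (u x - u y) \<le> A * (norm (u x - u y) * ?g y)"
        using mult_right_mono[OF A(2)[of "x - y"], of "norm (u x - u y)"]
        by (cases "y = x") (auto simp: mult_ac)
    qed (use that in \<open>simp add: lattice_kernel_nonneg\<close>)
  qed
  have kernel_sum: "((\<lambda>y. ?p t y) has_sum 1) UNIV" if "0 < t" for t
    using lattice_kernel_has_sum[of t, where ?'d = 'd] that
    by (subst has_sum_reindex_bij_witness[of UNIV "\<lambda>z. x - z" "\<lambda>y. x - y" UNIV "lattice_kernel t"]) auto
  \<comment> \<open>Writes u(y) as u(x) minus the difference: the constant part is summed by the
    unit mass of the kernel, the difference by \<open>weighted\<close>.\<close>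
  have semigroup_abs: "(\<lambda>y. norm (of_real (?p t y) * u y)) summable_on UNIV" if "0 < t" for t
  proof (rule summable_on_comparison_test)
    show "(\<lambda>y. ?p t y * norm (u x) + ?p t y * norm (u x - u y)) summable_on UNIV"
      using kernel_sum[OF that] weighted[OF that]
      by (intro summable_on_add summable_on_cmult_left) (auto intro: has_sum_imp_summable)
    fix y
    have "norm (u y) \<le> norm (u x) + norm (u x - u y)"
      using norm_triangle_ineq4[of "u x" "u x - u y"] by simp
    from mult_left_mono[OF this, of "?p t y"]
    show "norm (of_real (?p t y) * u y) \<le> ?p t y * norm (u x) + ?p t y * norm (u x - u y)"
      using that by (simp add: norm_mult lattice_kernel_nonneg algebra_simps)
  qed simp
  have semigroup: "((\<lambda>y. of_real (?p t y) * (u x - u y)) has_sum (u x - heat_semigroup t u x)) UNIV" if "0 < t" for t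
  proof -
    have "((\<lambda>y. of_real (?p t y) * u y) has_sum heat_semigroup t u x) UNIV"
      using abs_summable_summable[OF semigroup_abs[OF that]] that
      by (simp add: heat_semigroup_def heat_kernel_eq)
    then have "((\<lambda>y. - 1 * (of_real (?p t y) * u y)) has_sum (- 1 * heat_semigroup t u x)) UNIV"
      by (rule has_sum_cmult_right)
    moreover have "((\<lambda>y. of_real (?p t y) * u x) has_sum (of_real 1 * u x)) UNIV"
      by (intro has_sum_cmult_left has_sum_of_real kernel_sum that)
    ultimately have "((\<lambda>y. of_real (?p t y) * u x + - 1 * (of_real (?p t y) * u y)) has_sum
        (of_real 1 * u x + - 1 * heat_semigroup t u x)) UNIV"
      by (intro has_sum_add)
    then show ?thesis
      by (simp add: right_diff_distrib)
  qed
  \<comment> \<open>The indicator builds the time domain into the terms, so that Fubini applies over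
    all of \<open>lborel\<close>.\<close>
  define f where "f y t = indicator {0<..} t *\<^sub>R (of_real (?w t * ?p t y) * (u x - u y))" for y and t :: real
  obtain C where C: "0 \<le> C"
    "\<And>z :: int ^ 'd. z \<noteq> 0 \<Longrightarrow> set_integrable lborel {0<..} (\<lambda>t. ?w t * lattice_kernel t z)"
    "\<And>z :: int ^ 'd. z \<noteq> 0 \<Longrightarrow> (LBINT t:{0<..}. ?w t * lattice_kernel t z)
        \<le> C * real (l1_norm z) powr - (real CARD('d) + \<alpha>)"
    using lattice_kernel_time_integral[OF assms(1,2), where ?'d = 'd] by blast
  \<comment> \<open>At \<open>y = x\<close> the integral in \<open>?J\<close> diverges at 0 and
    takes its default value; the factor \<open>u x - u x\<close> makes both claims trivial
    there.\<close>
  have f_bochner: "has_bochner_integral lborel (f y) (of_real (?J y) * (u x - u y))"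
    and f_norm: "(\<integral>t. norm (f y t) \<partial>lborel) = ?J y * norm (u x - u y)" for y
  proof -
    let ?k = "\<lambda>t. indicator {0<..} t *\<^sub>R (?w t * ?p t y)"
    have k: "has_bochner_integral lborel ?k (?J y)" if "y \<noteq> x"
      using C(2)[of "x - y"] that
      by (simp add: set_integrable_def set_lebesgue_integral_def has_bochner_integral_iff)
    have f_eq: "f y = (\<lambda>t. of_real (?k t) * (u x - u y))"
      by (auto simp: f_def scaleR_conv_of_real)
    have n_eq: "norm (f y t) = ?k t * norm (u x - u y)" for t
      by (simp add: f_eq norm_mult abs_mult indicator_def lattice_kernel_nonneg)
    show "has_bochner_integral lborel (f y) (of_real (?J y) * (u x - u y))"
    proof (cases "y = x")
      case False
      then show ?thesis
        unfolding f_eq by (intro has_bochner_integral_mult_left has_bochner_integral_of_real k)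
    next
      case True
      then show ?thesis
        unfolding f_eq by (simp add: has_bochner_integral_zero)
    qed
    show "(\<integral>t. norm (f y t) \<partial>lborel) = ?J y * norm (u x - u y)"
    proof (cases "y = x")
      case False
      then show ?thesis
        unfolding n_eq by (intro has_bochner_integral_integral_eq has_bochner_integral_mult_left k)
    next
      case True
      then show ?thesis
        unfolding f_eq by simp
    qed
  qed
  have f_sum: "((\<lambda>y. f y t) has_sum (indicator {0<..} t *\<^sub>R frac_laplacian_integrand \<alpha> u x t)) UNIV" for t
  proof (cases "0 < t")
    case True
    from has_sum_cmult_right[OF semigroup[OF True], of "of_real (?w t)"] show ?thesis
      using True by (simp add: f_def frac_laplacian_integrand_def mult_ac)
  qed (simp add: f_def)
  have inf: "infinite (UNIV :: (int ^ 'd) set)"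
    by (rule infinite_UNIV_char_0)
  have abs: "(\<lambda>y. norm (f y t)) summable_on UNIV" for t
  proof (cases "0 < t")
    case True
    from summable_on_cmult_right[OF weighted[OF True], of "?w t"] show ?thesis
      using True by (simp add: f_def norm_mult lattice_kernel_nonneg mult_ac)
  qed (simp add: f_def)
  have abs_int: "(\<lambda>y. \<integral>t. norm (f y t) \<partial>lborel) summable_on UNIV"
  proof (rule summable_on_comparison_test[OF summable_on_cmult_right[OF g, of C]])
    fix y
    show "(\<integral>t. norm (f y t) \<partial>lborel) \<le> C * (norm (u x - u y) * ?g y)"
      using mult_right_mono[OF C(3)[of "x - y"], of "norm (u x - u y)"]
      unfolding f_norm by (cases "y = x") (auto simp: mult_ac)
  qed simp
  have int: "integrable lborel (f y)" for y
    using f_bochner by (rule integrable.intros)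
  have infsum_eq: "(\<Sum>\<^sub>\<infinity>y. f y t) = indicator {0<..} t *\<^sub>R frac_laplacian_integrand \<alpha> u x t" for t
    using f_sum by (rule infsumI)
  \<comment> \<open>The integral sees only positive times, where \<open>heat_kernel\<close> is the
    product kernel.\<close>
  have Q: "Q_kernel \<alpha> x y = ?c * ?J y" for y
    unfolding Q_kernel_def
    by (intro arg_cong2[where f = "(*)"] refl set_lebesgue_integral_cong) (auto simp: heat_kernel_eq)
  have "((\<lambda>y. of_real (?J y) * (u x - u y)) has_sum (LBINT t:{0<..}. frac_laplacian_integrand \<alpha> u x t)) UNIV"
    using has_sum_integral[OF inf int abs abs_int] has_bochner_integral_integral_eq[OF f_bochner]
    by (simp add: infsum_eq set_lebesgue_integral_def)
  from has_sum_cmult_right[OF this, of "of_real ?c"]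
  have "((\<lambda>y. of_real (Q_kernel \<alpha> x y) * (u x - u y)) has_sum frac_laplacian \<alpha> u x) UNIV"
    by (simp add: Q frac_laplacian_def mult.assoc)
  then have "((\<lambda>y. of_real (Q_kernel \<alpha> x y) * (u x - u y)) has_sum frac_laplacian \<alpha> u x) (UNIV - {x})"
    by (rule has_sum_cong_neutral[THEN iffD1, rotated 3]) auto
  moreover have "set_integrable lborel {0<..} (frac_laplacian_integrand \<alpha> u x)"
    using integrable_infsum[OF inf int abs abs_int] by (simp add: infsum_eq set_integrable_def)
  ultimately show "(\<forall>t>0. (\<lambda>y. norm (of_real (heat_kernel t x y) * u y)) summable_on UNIV) \<and>
    set_integrable lborel {0<..} (frac_laplacian_integrand \<alpha> u x) \<and>
    ((\<lambda>y. of_real (Q_kernel \<alpha> x y) * (u x - u y)) has_sum frac_laplacian \<alpha> u x) (UNIV - {x})"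
    using semigroup_abs by (simp add: heat_kernel_eq)
qed

end
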